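(* Let $m\ge 2$ be an integer. (1) If $a$ and $b$ are integers with $\gcd(ab,m)=1$, then $$C_{m}(ab)\equiv C_{m}(a)+C_{m}(b)\pmod{m}.$$ (2) If $a,k$ are integers with $\gcd(a,m)=1$, and $\alpha$ is a positive integer, then $$C_{m}(a+km^{\alpha})\equiv C_{m}(a)+\frac{k\lambda(m)}{a}m^{\alpha-1}\pmod{m^{\alpha}}.$$
   Context: $\lambda$ denotes the Carmichael function: $\lambda(m)$ is the exponent of the multiplicative group $(\mathbb{Z}/m\mathbb{Z})^{*}$. For coprime integers $m\ge 2$ and $a$, the Carmichael quotient of $m$ with base $a$ is the integer $C_{m}(a)=\frac{a^{\lambda(m)}-1}{m}$. In the congruence modulo $m^{\alpha}$, $\frac{1}{a}$ denotes an inverse of $a$ modulo $m^{\alpha}$. *)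

theory Defs
  imports "HOL-Number_Theory.Residue_Primitive_Roots"
begin

text \<open>
  The library function \<^const>\<open>Carmichael\<close> is defined as the LCM of the element orders.
  The next lemma confirms that \<open>Carmichael m\<close> is the exponent of the unit group modulo \<open>m\<close>:
  the exponents annihilating that group are exactly its multiples.
\<close>

lemma Carmichael_exponent:
  assumes "m \<ge> 2"
  shows "(\<forall>a. coprime m a \<longrightarrow> [a ^ k = 1] (mod m)) \<longleftrightarrow> Carmichael m dvd k"
proof
  assume *: "\<forall>a. coprime m a \<longrightarrow> [a ^ k = 1] (mod m)"
  show "Carmichael m dvd k"
    unfolding Carmichael_def
  proof (rule Lcm_least, safe)
    fix a assume "a \<in> totatives m"
    then have "coprime m a"
      by (simp add: totatives_def coprime_commute)
    with * show "ord m a dvd k"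
      using ord_divides by blast
  qed
qed (use Carmichael_divides in blast)

text \<open>
  The division is exact when \<open>a\<close> is coprime to \<open>m\<close>, as shown below; other \<open>a\<close> are
  outside the intended domain.
\<close>

definition Carmichael_quotient :: "nat \<Rightarrow> int \<Rightarrow> int" where
  "Carmichael_quotient m a = (a ^ Carmichael m - 1) div int m"

lemma mult_Carmichael_quotient:
  assumes "m \<ge> 2" "coprime a (int m)"
  shows "int m * Carmichael_quotient m a = a ^ Carmichael m - 1"
proof -
  define b where "b = nat (a mod int m)"
  have b: "int b = a mod int m"
    using assms by (simp add: b_def)
  have "coprime (int b) (int m)"
    using assms b by (simp add: coprime_commute)
  then have "coprime m b"
    by (simp add: coprime_commute)
  then have "[b ^ Carmichael m = 1] (mod m)"
    by (intro Carmichael_divides) auto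
  then have "[int b ^ Carmichael m = 1] (mod int m)"
    by (metis cong_int_iff of_nat_1 of_nat_power)
  moreover have "[a = int b] (mod int m)"
    by (simp add: b cong_def)
  ultimately have "[a ^ Carmichael m = 1] (mod int m)"
    using cong_pow cong_trans by blast
  then have "int m dvd a ^ Carmichael m - 1"
    by (simp add: cong_iff_dvd_diff)
  then show ?thesis
    by (simp add: Carmichael_quotient_def)
qed

end

theory Submission
  imports Defs
begin

text \<open>
  Multiplied by \<open>m\<close>, both congruences become statements about \<open>a ^ \<lambda>(m) = 1 + m C(a)\<close>:
  (1) expands the product \<open>(1 + m C(a)) (1 + m C(b))\<close>, and (2) is the binomial expansion of
  \<open>(a + k m ^ \<alpha>) ^ \<lambda>(m)\<close> to first order, where \<open>a ^ (\<lambda>(m) - 1)\<close> is an inverse of \<open>a\<close>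
  modulo \<open>m\<close>.
\<close>

text \<open>Induction on \<open>n\<close>: multiplying the expansion by \<open>x + y\<close> creates
  only one new second-order term, \<open>of_nat (Suc n) * x ^ n * y\<^sup>2\<close>. The exponent
  \<open>Suc n\<close> avoids truncated subtraction in the derivative.\<close>

lemma power_add_first_order:
  fixes x y :: "'a::comm_ring_1"
  shows "y\<^sup>2 dvd (x + y) ^ Suc n - (x ^ Suc n + of_nat (Suc n) * x ^ n * y)"
proof (induction n)
  case (Suc n)
  then obtain c where c: "(x + y) ^ Suc n - (x ^ Suc n + of_nat (Suc n) * x ^ n * y) = y\<^sup>2 * c" ..
  define p where "p = (x + y) ^ Suc n"
  have p: "p = x * x ^ n + of_nat (Suc n) * x ^ n * y + y\<^sup>2 * c"
    using c by (simp add: p_def algebra_simps)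
  have "(x + y) ^ Suc (Suc n) = (x + y) * p"
    by (simp add: p_def)
  then have "(x + y) ^ Suc (Suc n) - (x ^ Suc (Suc n) + of_nat (Suc (Suc n)) * x ^ Suc n * y)
      = y\<^sup>2 * (of_nat (Suc n) * x ^ n + (x + y) * c)"
    unfolding p by (simp add: algebra_simps power2_eq_square)
  then show ?case by (metis dvd_triv_left)
qed simp

lemma Carmichael_quotient_mult_cong:
  assumes "m \<ge> 2" "coprime (a * b) (int m)"
  shows "[Carmichael_quotient m (a * b)
            = Carmichael_quotient m a + Carmichael_quotient m b] (mod int m)"
proof -
  let ?C = "Carmichael_quotient m" and ?M = "int m"
  have "coprime a ?M" "coprime b ?M"
    using assms(2) by simp_all
  then have pow: "a ^ Carmichael m = ?M * ?C a + 1" "b ^ Carmichael m = ?M * ?C b + 1"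
    using assms(1) by (simp_all add: mult_Carmichael_quotient)
  have "?M * ?C (a * b) = a ^ Carmichael m * b ^ Carmichael m - 1"
    using assms by (simp add: mult_Carmichael_quotient power_mult_distrib)
  also have "\<dots> = ?M * (?C a + ?C b + ?M * (?C a * ?C b))"
    unfolding pow by (simp add: algebra_simps)
  \<comment> \<open>Cancelling \<open>?M\<close> leaves one factor \<open>?M\<close> on the cross
    term, so that term vanishes modulo \<open>m\<close>.\<close>
  finally have "?C (a * b) = ?C a + ?C b + ?M * (?C a * ?C b)"
    using assms(1) by simp
  then show ?thesis
    by (simp add: cong_iff_dvd_diff)
qed

text \<open>Dividing by \<open>m\<close> costs one factor of \<open>m\<close>, so the powers are
  compared modulo \<open>m ^ Suc \<alpha>\<close>.\<close>

lemma Carmichael_quotient_shift_cong: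
  fixes a k a_inv :: int
  assumes "m \<ge> 2" "coprime a (int m)" "\<alpha> > 0" "[a * a_inv = 1] (mod int m ^ \<alpha>)"
  shows "[Carmichael_quotient m (a + k * int m ^ \<alpha>)
            = Carmichael_quotient m a + k * int (Carmichael m) * a_inv * int m ^ (\<alpha> - 1)]
           (mod int m ^ \<alpha>)"
proof -
  let ?C = "Carmichael_quotient m" and ?M = "int m"
  let ?a' = "a + k * ?M ^ \<alpha>"
  obtain n where n: "Carmichael m = Suc n"
    using Carmichael_pos[of m] gr0_implies_Suc by blast
  obtain \<beta> where \<beta>: "\<alpha> = Suc \<beta>"
    using assms(3) gr0_implies_Suc by blast
  have "[a = ?a'] (mod ?M)"
    by (simp add: \<beta> cong_iff_dvd_diff)
  with assms(2) have "coprime ?a' ?M"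
    using cong_imp_coprime by blast
  then have C': "?M * ?C ?a' = ?a' ^ Suc n - 1"
    using mult_Carmichael_quotient[OF assms(1), of ?a'] n by simp
  have C: "?M * ?C a = a ^ Suc n - 1"
    using mult_Carmichael_quotient[OF assms(1,2)] n by simp
  \<comment> \<open>The linear term already carries \<open>?M ^ \<alpha>\<close>, so
    \<open>a ^ n\<close> and \<open>a_inv\<close> need to agree only modulo
    \<open>?M\<close>.\<close>
  have "[a * a_inv = 1] (mod ?M)"
    using assms(4) by (rule cong_dvd_modulus) (simp add: \<beta>)
  moreover have "[a * a ^ n = 1] (mod ?M)"
    unfolding cong_iff_dvd_diff power_Suc[symmetric] C[symmetric] by simp
  ultimately have "[a * a ^ n = a * a_inv] (mod ?M)"
    using cong_sym cong_trans by blast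
  then have inv: "?M dvd a ^ n - a_inv"
    using assms(2) by (metis cong_iff_dvd_diff cong_mult_lcancel)
  \<comment> \<open>The second-order remainder vanishes because
    \<open>2 * \<alpha> \<ge> Suc \<alpha>\<close> for positive \<open>\<alpha>\<close>.\<close>
  have "?M ^ Suc \<alpha> dvd (k * ?M ^ \<alpha>)\<^sup>2"
    by (simp add: \<beta> power2_eq_square)
  then have "?M ^ Suc \<alpha> dvd ?a' ^ Suc n - (a ^ Suc n + of_nat (Suc n) * a ^ n * (k * ?M ^ \<alpha>))"
    using power_add_first_order dvd_trans by blast
  \<comment> \<open>Adding this multiple replaces \<open>a ^ n\<close> by \<open>a_inv\<close> in
    the linear term.\<close>
  moreover have "?M ^ Suc \<alpha> dvd (of_nat (Suc n) * k) * (?M ^ \<alpha> * (a ^ n - a_inv))"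
    unfolding power_Suc2 using inv by (intro dvd_mult[OF mult_dvd_mono] dvd_refl)
  ultimately have "?M ^ Suc \<alpha> dvd
      (?a' ^ Suc n - (a ^ Suc n + of_nat (Suc n) * a ^ n * (k * ?M ^ \<alpha>)))
      + (of_nat (Suc n) * k) * (?M ^ \<alpha> * (a ^ n - a_inv))"
    by (rule dvd_add)
  also have "\<dots> = ?M * ?C ?a' - ?M * ?C a - of_nat (Suc n) * k * a_inv * ?M ^ \<alpha>"
    unfolding C C' by (simp only: algebra_simps)
  \<comment> \<open>A factor \<open>?M\<close> is split off \<open>?M ^ \<alpha>\<close>, which
    produces the exponent \<open>\<alpha> - 1\<close>.\<close>
  also have "\<dots> = ?M * (?C ?a' - (?C a + k * int (Carmichael m) * a_inv * ?M ^ (\<alpha> - 1)))"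
    by (simp add: \<beta> n algebra_simps)
  finally show ?thesis
    using assms(1) by (simp add: cong_iff_dvd_diff)
qed

theorem proposition2p2:
  fixes m :: nat
  assumes "m \<ge> 2"
  shows "(\<forall>a b :: int. coprime (a * b) (int m) \<longrightarrow>
            [Carmichael_quotient m (a * b)
               = Carmichael_quotient m a + Carmichael_quotient m b] (mod int m))
       \<and> (\<forall>(a :: int) (k :: int) (\<alpha> :: nat) (a_inv :: int).
            coprime a (int m) \<and> \<alpha> > 0 \<and> [a * a_inv = 1] (mod int m ^ \<alpha>) \<longrightarrow>
            [Carmichael_quotient m (a + k * int m ^ \<alpha>)
               = Carmichael_quotient m a + k * int (Carmichael m) * a_inv * int m ^ (\<alpha> - 1)]
              (mod int m ^ \<alpha>))"
  using Carmichael_quotient_mult_cong[OF assms] Carmichael_quotient_shift_cong[OF assms] by blast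

end
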